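(* On $\mathbb R^3$ with coordinates $(x^1,x^2,x^3)$, let $\eta=\frac12\big(\cosh(x^3)\,dx^1+\sinh(x^3)\,dx^2\big)$, let $\xi=2\big(\cosh(x^3)\frac{\partial}{\partial x^1}-\sinh(x^3)\frac{\partial}{\partial x^2}\big)$, and let $g$ be the pseudo-Riemannian metric $g=\frac14\big((dx^1)^2-(dx^2)^2+(dx^3)^2\big)$. Then there is a $(1,1)$-tensor field $\varphi$ on $\mathbb R^3$ such that $(\varphi,\xi,\eta,g)$ is a paracontact metric structure, and the metric $g$ is flat. In particular, flat paracontact metric structures exist in dimension three.
   Context: An almost paracontact structure $(\varphi,\xi,\eta)$ on a smooth manifold $M$ of dimension $2n+1$ consists of a $(1,1)$-tensor field $\varphi$, a vector field $\xi$ and a $1$-form $\eta$ such that: (i) $\varphi(\xi)=0$ and $\eta\circ\varphi=0$; (ii) $\eta(\xi)=1$ and $\varphi^2=\mathrm{id}-\eta\otimes\xi$; (iii) $\varphi$ induces an almost paracomplex structure on each fibre of the horizontal distribution $\mathbb D=\ker\eta$, i.e. $\varphi|_{\mathbb D}$ squares to the identity and its $+1$ and $-1$ eigenspaces in each fibre both have dimension $n$. An almost paracontact metric structure $(\varphi,\xi,\eta,g)$ is an almost paracontact structure together with a pseudo-Riemannian metric $g$ satisfying $g(\varphi X,\varphi Y)=-g(X,Y)+\eta(X)\eta(Y)$ for all vector fields $X,Y$. A paracontact metric structure is an almost paracontact metric structure such that $g(X,\varphi Y)=d\eta(X,Y)$ for all vector fields $X,Y$, with the convention $d\eta(X,Y)=\frac12\big(X\eta(Y)-Y\eta(X)-\eta([X,Y])\big)$.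 "Flat" means that the Riemann curvature tensor of the Levi-Civita connection of $g$ vanishes. *)

theory Defs
  imports "HOL-Analysis.Analysis"
begin

text \<open>
  The manifold is a Euclidean space, covered by a single chart: the tangent space at every point is
  identified with the space itself, so that a vector field is a function \<open>'a \<Rightarrow> 'a\<close>, and a tensor
  field is a family, indexed by the points, of (multi)linear maps.
\<close>

primrec Ck :: "nat \<Rightarrow> ('a::real_normed_vector \<Rightarrow> 'b::real_normed_vector) \<Rightarrow> bool" where
  "Ck 0 f \<longleftrightarrow> continuous_on UNIV f"
| "Ck (Suc k) f \<longleftrightarrow>
     (\<forall>x. f differentiable (at x)) \<and> (\<forall>v. Ck k (\<lambda>x. frechet_derivative f (at x) v))"

definition smooth :: "('a::real_normed_vector \<Rightarrow> 'b::real_normed_vector) \<Rightarrow> bool" where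
  "smooth f \<longleftrightarrow> (\<forall>k. Ck k f)"

definition vector_field :: "('a::euclidean_space \<Rightarrow> 'a) \<Rightarrow> bool" where
  "vector_field X \<longleftrightarrow> smooth X"

definition one_form :: "('a::euclidean_space \<Rightarrow> 'a \<Rightarrow> real) \<Rightarrow> bool" where
  "one_form \<eta> \<longleftrightarrow> (\<forall>x. linear (\<eta> x)) \<and> (\<forall>v. smooth (\<lambda>x. \<eta> x v))"

definition tensor_field_1_1 :: "('a::euclidean_space \<Rightarrow> 'a \<Rightarrow> 'a) \<Rightarrow> bool" where
  "tensor_field_1_1 \<phi> \<longleftrightarrow> (\<forall>x. linear (\<phi> x)) \<and> (\<forall>v. smooth (\<lambda>x. \<phi> x v))"

definition pseudo_riemannian_metric :: "('a::euclidean_space \<Rightarrow> 'a \<Rightarrow> 'a \<Rightarrow> real) \<Rightarrow> bool" where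
  "pseudo_riemannian_metric g \<longleftrightarrow>
     (\<forall>x. bilinear (g x)) \<and>
     (\<forall>u v. smooth (\<lambda>x. g x u v)) \<and>
     (\<forall>x u v. g x u v = g x v u) \<and>
     (\<forall>x u. (\<forall>v. g x u v = 0) \<longrightarrow> u = 0)"

text \<open>The function \<open>X f\<close>, for a vector field \<open>X\<close> and a function \<open>f\<close>; \<open>f\<close> may be vector-valued,
  in which case the derivative is taken componentwise.\<close>

definition dir_deriv ::
  "('a::euclidean_space \<Rightarrow> 'a) \<Rightarrow> ('a \<Rightarrow> 'b::real_normed_vector) \<Rightarrow> 'a \<Rightarrow> 'b" where
  "dir_deriv X f x = frechet_derivative f (at x) (X x)"

definition lie_bracket ::
  "('a::euclidean_space \<Rightarrow> 'a) \<Rightarrow> ('a \<Rightarrow> 'a) \<Rightarrow> 'a \<Rightarrow> 'a" where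
  "lie_bracket X Y x = dir_deriv X Y x - dir_deriv Y X x"

text \<open>The exterior derivative, in the convention with the factor \<open>1/2\<close>.\<close>

definition ext_deriv ::
  "('a::euclidean_space \<Rightarrow> 'a \<Rightarrow> real) \<Rightarrow> ('a \<Rightarrow> 'a) \<Rightarrow> ('a \<Rightarrow> 'a) \<Rightarrow> 'a \<Rightarrow> real" where
  "ext_deriv \<eta> X Y x =
     1/2 * (dir_deriv X (\<lambda>y. \<eta> y (Y y)) x - dir_deriv Y (\<lambda>y. \<eta> y (X y)) x
            - \<eta> x (lie_bracket X Y x))"

definition almost_paracontact_structure ::
  "('a::euclidean_space \<Rightarrow> 'a \<Rightarrow> 'a) \<Rightarrow> ('a \<Rightarrow> 'a) \<Rightarrow> ('a \<Rightarrow> 'a \<Rightarrow> real) \<Rightarrow> bool" where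
  "almost_paracontact_structure \<phi> \<xi> \<eta> \<longleftrightarrow>
     tensor_field_1_1 \<phi> \<and> vector_field \<xi> \<and> one_form \<eta> \<and>
     (\<forall>x. \<phi> x (\<xi> x) = 0) \<and>
     (\<forall>x v. \<eta> x (\<phi> x v) = 0) \<and>
     (\<forall>x. \<eta> x (\<xi> x) = 1) \<and>
     (\<forall>x v. \<phi> x (\<phi> x v) = v - \<eta> x v *\<^sub>R \<xi> x) \<and>
     (\<exists>n. DIM('a) = 2 * n + 1 \<and>
        (\<forall>x. (\<forall>v. \<eta> x v = 0 \<longrightarrow> \<phi> x (\<phi> x v) = v) \<and>
             dim {v. \<eta> x v = 0 \<and> \<phi> x v = v} = n \<and>
             dim {v. \<eta> x v = 0 \<and> \<phi> x v = - v} = n))"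

definition almost_paracontact_metric_structure ::
  "('a::euclidean_space \<Rightarrow> 'a \<Rightarrow> 'a) \<Rightarrow> ('a \<Rightarrow> 'a) \<Rightarrow> ('a \<Rightarrow> 'a \<Rightarrow> real) \<Rightarrow>
   ('a \<Rightarrow> 'a \<Rightarrow> 'a \<Rightarrow> real) \<Rightarrow> bool" where
  "almost_paracontact_metric_structure \<phi> \<xi> \<eta> g \<longleftrightarrow>
     almost_paracontact_structure \<phi> \<xi> \<eta> \<and> pseudo_riemannian_metric g \<and>
     (\<forall>X Y. vector_field X \<longrightarrow> vector_field Y \<longrightarrow>
        (\<forall>x. g x (\<phi> x (X x)) (\<phi> x (Y x)) = - g x (X x) (Y x) + \<eta> x (X x) * \<eta> x (Y x)))"

definition paracontact_metric_structure ::
  "('a::euclidean_space \<Rightarrow> 'a \<Rightarrow> 'a) \<Rightarrow> ('a \<Rightarrow> 'a) \<Rightarrow> ('a \<Rightarrow> 'a \<Rightarrow> real) \<Rightarrow>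
   ('a \<Rightarrow> 'a \<Rightarrow> 'a \<Rightarrow> real) \<Rightarrow> bool" where
  "paracontact_metric_structure \<phi> \<xi> \<eta> g \<longleftrightarrow>
     almost_paracontact_metric_structure \<phi> \<xi> \<eta> g \<and>
     (\<forall>X Y. vector_field X \<longrightarrow> vector_field Y \<longrightarrow>
        (\<forall>x. g x (X x) (\<phi> x (Y x)) = ext_deriv \<eta> X Y x))"

text \<open>A connection maps vector fields \<open>X\<close>, \<open>Y\<close> to \<open>\<nabla>\<^sub>X Y\<close>; its values on functions that are not
  smooth are irrelevant.\<close>

definition affine_connection ::
  "(('a::euclidean_space \<Rightarrow> 'a) \<Rightarrow> ('a \<Rightarrow> 'a) \<Rightarrow> 'a \<Rightarrow> 'a) \<Rightarrow> bool" where
  "affine_connection D \<longleftrightarrow>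
     (\<forall>X Y. vector_field X \<longrightarrow> vector_field Y \<longrightarrow> vector_field (D X Y)) \<and>
     (\<forall>X X' Y. vector_field X \<longrightarrow> vector_field X' \<longrightarrow> vector_field Y \<longrightarrow>
        (\<forall>x. D (\<lambda>y. X y + X' y) Y x = D X Y x + D X' Y x)) \<and>
     (\<forall>f X Y. smooth f \<longrightarrow> vector_field X \<longrightarrow> vector_field Y \<longrightarrow>
        (\<forall>x. D (\<lambda>y. f y *\<^sub>R X y) Y x = f x *\<^sub>R D X Y x)) \<and>
     (\<forall>X Y Y'. vector_field X \<longrightarrow> vector_field Y \<longrightarrow> vector_field Y' \<longrightarrow>
        (\<forall>x. D X (\<lambda>y. Y y + Y' y) x = D X Y x + D X Y' x)) \<and>
     (\<forall>f X Y. smooth f \<longrightarrow> vector_field X \<longrightarrow> vector_field Y \<longrightarrow>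
        (\<forall>x. D X (\<lambda>y. f y *\<^sub>R Y y) x = dir_deriv X f x *\<^sub>R Y x + f x *\<^sub>R D X Y x))"

definition levi_civita_connection ::
  "('a::euclidean_space \<Rightarrow> 'a \<Rightarrow> 'a \<Rightarrow> real) \<Rightarrow>
   (('a \<Rightarrow> 'a) \<Rightarrow> ('a \<Rightarrow> 'a) \<Rightarrow> 'a \<Rightarrow> 'a) \<Rightarrow> bool" where
  "levi_civita_connection g D \<longleftrightarrow>
     affine_connection D \<and>
     (\<forall>X Y. vector_field X \<longrightarrow> vector_field Y \<longrightarrow>
        (\<forall>x. D X Y x - D Y X x = lie_bracket X Y x)) \<and>
     (\<forall>X Y Z. vector_field X \<longrightarrow> vector_field Y \<longrightarrow> vector_field Z \<longrightarrow>
        (\<forall>x. dir_deriv X (\<lambda>y. g y (Y y) (Z y)) x = g x (D X Y x) (Z x) + g x (Y x) (D X Z x)))"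

definition curvature ::
  "(('a::euclidean_space \<Rightarrow> 'a) \<Rightarrow> ('a \<Rightarrow> 'a) \<Rightarrow> 'a \<Rightarrow> 'a) \<Rightarrow>
   ('a \<Rightarrow> 'a) \<Rightarrow> ('a \<Rightarrow> 'a) \<Rightarrow> ('a \<Rightarrow> 'a) \<Rightarrow> 'a \<Rightarrow> 'a" where
  "curvature D X Y Z x = D X (D Y Z) x - D Y (D X Z) x - D (lie_bracket X Y) Z x"

text \<open>The Levi-Civita connection of a pseudo-Riemannian metric exists, and its values on vector
  fields are unique; so the existential quantifier below just names it.\<close>

definition flat_metric :: "('a::euclidean_space \<Rightarrow> 'a \<Rightarrow> 'a \<Rightarrow> real) \<Rightarrow> bool" where
  "flat_metric g \<longleftrightarrow>
     (\<exists>D. levi_civita_connection g D \<and>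
        (\<forall>X Y Z. vector_field X \<longrightarrow> vector_field Y \<longrightarrow> vector_field Z \<longrightarrow>
           (\<forall>x. curvature D X Y Z x = 0)))"

end

theory Submission
  imports Defs
begin

text \<open>
  Put \<open>E = cosh x\<^sub>3 \<partial>\<^sub>2 - sinh x\<^sub>3 \<partial>\<^sub>1\<close>. Then \<open>\<xi>\<close>, \<open>E\<close> and \<open>\<partial>\<^sub>3\<close> form a global frame that is
  orthogonal for \<open>g\<close>, and \<open>E\<close>, \<open>\<partial>\<^sub>3\<close> span \<open>ker \<eta>\<close> with \<open>g(E, E) = -1/4 = - g(\<partial>\<^sub>3, \<partial>\<^sub>3)\<close>. Only the
  third coordinate occurs in the coefficients of \<open>\<eta>\<close>, so \<open>d\<eta>(X, Y)\<close> is
  \<open>(X\<^sub>3 \<beta>(Y) - Y\<^sub>3 \<beta>(X)) / 4\<close> with \<open>\<beta> = sinh x\<^sub>3 dx\<^sub>1 + cosh x\<^sub>3 dx\<^sub>2\<close>. Raising an index with \<open>g\<close> turns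
  this into the endomorphism \<open>\<phi> = dx\<^sub>3 \<otimes> E + \<beta> \<otimes> \<partial>\<^sub>3\<close>, which kills \<open>\<xi>\<close> and interchanges \<open>E\<close> and
  \<open>\<partial>\<^sub>3\<close>. All the algebraic conditions follow from this description and from
  \<open>cosh\<^sup>2 - sinh\<^sup>2 = 1\<close>; in particular the eigenspaces of \<open>\<phi>\<close> on \<open>ker \<eta>\<close> are the lines through
  \<open>\<partial>\<^sub>3 + E\<close> and \<open>\<partial>\<^sub>3 - E\<close>.

  The metric has constant coefficients, so componentwise differentiation \<open>\<nabla>\<^sub>X Y = X Y\<close> is its
  Levi-Civita connection (\<open>levi_civita_constant_metric\<close>). For this connection
  \<open>\<nabla>\<^sub>X \<nabla>\<^sub>Y Z = D\<^sup>2Z(Y, X) + DZ(\<nabla>\<^sub>X Y)\<close> (\<open>dir_deriv_dir_deriv\<close>), so that the curvature is the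
  antisymmetric part of \<open>D\<^sup>2Z\<close>, and it vanishes because second derivatives are symmetric
  (\<open>second_derivative_symmetric\<close>).
\<close>

section \<open>Smooth maps\<close>

lemma Ck_SucD: "Ck (Suc k) f \<Longrightarrow> Ck k f"
proof (induction k arbitrary: f)
  case 0
  then show ?case
    by (auto simp: continuous_on_eq_continuous_within intro!: differentiable_imp_continuous_within)
next
  case (Suc k)
  then show ?case by auto
qed

text \<open>Higher smoothness is checked on a derivative given by a formula, without mentioning the
  chosen \<open>frechet_derivative\<close>.\<close>

lemma Ck_Suc_intro:
  assumes "\<And>x. (f has_derivative f' x) (at x)" and "\<And>v. Ck k (\<lambda>x. f' x v)"
  shows "Ck (Suc k) f"
proof -
  have "frechet_derivative f (at x) = f' x" for x
    using frechet_derivative_at[OF assms(1)] by simp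
  then show ?thesis
    using assms unfolding Ck.simps differentiable_def by auto
qed

lemma Ck_Suc_has_derivative:
  "Ck (Suc k) f \<Longrightarrow> (f has_derivative frechet_derivative f (at x)) (at x)"
  by (simp add: frechet_derivative_works)

lemma Ck_const: "Ck k (\<lambda>x. c)"
proof (induction k arbitrary: c)
  case (Suc k)
  show ?case
    by (rule Ck_Suc_intro[where f' = "\<lambda>x v. 0"]) (auto intro: Suc)
qed simp

lemma Ck_linear: "bounded_linear L \<Longrightarrow> Ck k f \<Longrightarrow> Ck k (\<lambda>x. L (f x))"
proof (induction k arbitrary: f)
  case 0
  then show ?case by (simp add: bounded_linear.continuous_on)
next
  case (Suc k)
  show ?case
    by (rule Ck_Suc_intro[OF bounded_linear.has_derivative[OF Suc.prems(1)
          Ck_Suc_has_derivative[OF Suc.prems(2)]]])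
      (use Suc in auto)
qed

lemma Ck_add: "Ck k f \<Longrightarrow> Ck k g \<Longrightarrow> Ck k (\<lambda>x. f x + g x)"
proof (induction k arbitrary: f g)
  case 0
  then show ?case by (simp add: continuous_on_add)
next
  case (Suc k)
  show ?case
    by (rule Ck_Suc_intro[OF has_derivative_add[OF Ck_Suc_has_derivative[OF Suc.prems(1)]
          Ck_Suc_has_derivative[OF Suc.prems(2)]]])
      (use Suc in auto)
qed

text \<open>The product rule involves \<open>f\<close> and \<open>g\<close> themselves beside their derivatives, so the induction
  step also needs that they are of the lower class.\<close>

lemma Ck_bilinear:
  assumes "bounded_bilinear B"
  shows "Ck k f \<Longrightarrow> Ck k g \<Longrightarrow> Ck k (\<lambda>x. B (f x) (g x))"
proof (induction k arbitrary: f g)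
  case 0
  then show ?case by (simp add: bounded_bilinear.continuous_on[OF assms])
next
  case (Suc k)
  show ?case
    by (rule Ck_Suc_intro[OF bounded_bilinear.FDERIV[OF assms Ck_Suc_has_derivative[OF Suc.prems(1)]
          Ck_Suc_has_derivative[OF Suc.prems(2)]]])
      (use Suc Ck_SucD[of k f] Ck_SucD[of k g] in \<open>auto intro!: Ck_add\<close>)
qed

lemma smooth_has_derivative:
  "smooth f \<Longrightarrow> (f has_derivative frechet_derivative f (at x)) (at x)"
  unfolding smooth_def using Ck_Suc_has_derivative by blast

lemma smooth_frechet_derivative: "smooth f \<Longrightarrow> smooth (\<lambda>x. frechet_derivative f (at x) v)"
  unfolding smooth_def using Ck.simps(2) by blast

lemma smooth_imp_continuous: "smooth f \<Longrightarrow> continuous_on UNIV f"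
  unfolding smooth_def using Ck.simps(1) by blast

lemma smooth_const: "smooth (\<lambda>x. c)"
  by (simp add: smooth_def Ck_const)

lemma smooth_linear: "bounded_linear L \<Longrightarrow> smooth f \<Longrightarrow> smooth (\<lambda>x. L (f x))"
  by (simp add: smooth_def Ck_linear)

lemma smooth_add: "smooth f \<Longrightarrow> smooth g \<Longrightarrow> smooth (\<lambda>x. f x + g x)"
  by (simp add: smooth_def Ck_add)

lemma smooth_bilinear:
  "bounded_bilinear B \<Longrightarrow> smooth f \<Longrightarrow> smooth g \<Longrightarrow> smooth (\<lambda>x. B (f x) (g x))"
  by (simp add: smooth_def Ck_bilinear)

lemmas smooth_scaleR = smooth_bilinear[OF bounded_bilinear_scaleR]
lemmas smooth_mult = smooth_bilinear[OF bounded_bilinear_mult]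

lemma smooth_diff: "smooth f \<Longrightarrow> smooth g \<Longrightarrow> smooth (\<lambda>x. f x - g x)"
  using smooth_add[OF _ smooth_linear[OF bounded_linear_minus[OF bounded_linear_ident]], of f g]
  by simp

lemma smooth_sum: "(\<And>i. i \<in> I \<Longrightarrow> smooth (f i)) \<Longrightarrow> smooth (\<lambda>x. \<Sum>i\<in>I. f i x)"
  by (induction I rule: infinite_finite_induct) (auto intro: smooth_add smooth_const)

lemma has_derivative_cosh_sinh_linear:
  fixes L :: "'a::real_normed_vector \<Rightarrow> real"
  assumes "bounded_linear L"
  shows "((\<lambda>x. cosh (L x)) has_derivative (\<lambda>v. L v * sinh (L x))) (at x)"
    and "((\<lambda>x. sinh (L x)) has_derivative (\<lambda>v. L v * cosh (L x))) (at x)"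
proof -
  note L = bounded_linear_imp_has_derivative[OF assms]
  have c: "(cosh has_derivative (\<lambda>t. t * sinh r)) (at r)"
    and s: "(sinh has_derivative (\<lambda>t. t * cosh r)) (at r)" for r :: real
    using has_derivative_cosh[of "\<lambda>x. x" 1 r UNIV] has_derivative_sinh[of "\<lambda>x. x" 1 r UNIV]
    by (simp_all add: mult.commute)
  show "((\<lambda>x. cosh (L x)) has_derivative (\<lambda>v. L v * sinh (L x))) (at x)"
    by (rule has_derivative_compose[OF L c])
  show "((\<lambda>x. sinh (L x)) has_derivative (\<lambda>v. L v * cosh (L x))) (at x)"
    by (rule has_derivative_compose[OF L s])
qed

lemma smooth_cosh_sinh_linear:
  fixes L :: "'a::real_normed_vector \<Rightarrow> real"
  assumes "bounded_linear L"
  shows "smooth (\<lambda>x. cosh (L x))" and "smooth (\<lambda>x. sinh (L x))"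
proof -
  note d = has_derivative_cosh_sinh_linear[OF assms]
  \<comment> \<open>Each of the two functions is, up to a factor, the derivative of the other.\<close>
  have "Ck k (\<lambda>x. cosh (L x)) \<and> Ck k (\<lambda>x. sinh (L x))" for k
  proof (induction k)
    case 0
    then show ?case
      using d by (auto simp: continuous_on_eq_continuous_within intro!: has_derivative_continuous)
  next
    case (Suc k)
    then show ?case
      by (auto intro!: Ck_Suc_intro[OF d(1)] Ck_Suc_intro[OF d(2)]
          Ck_linear[OF bounded_linear_mult_right] simp del: Ck.simps)
  qed
  then show "smooth (\<lambda>x. cosh (L x))" "smooth (\<lambda>x. sinh (L x))"
    by (auto simp: smooth_def)
qed

section \<open>Symmetry of the second derivative\<close>

text \<open>The second difference over the parallelogram spanned by \<open>h u\<close> and \<open>h v\<close> is a difference in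
  direction \<open>u\<close> of a difference in direction \<open>v\<close>; the mean value theorem applies to each. Its left
  side is symmetric in \<open>u\<close> and \<open>v\<close>, which is the source of the symmetry of the second derivative.\<close>

lemma second_difference_mean_value:
  fixes f :: "'a::real_normed_vector \<Rightarrow> real"
  assumes f: "smooth f" and h: "0 < h"
  shows "\<exists>s t. 0 < s \<and> s < h \<and> 0 < t \<and> t < h \<and>
    f (x + h *\<^sub>R u + h *\<^sub>R v) - f (x + h *\<^sub>R u) - f (x + h *\<^sub>R v) + f x =
    h * h * frechet_derivative (\<lambda>y. frechet_derivative f (at y) u) (at (x + s *\<^sub>R u + t *\<^sub>R v)) v"
proof -
  have line: "((\<lambda>r. F (p + r *\<^sub>R w)) has_real_derivative frechet_derivative F (at (p + r *\<^sub>R w)) w) (at r)"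
    if "smooth F" for F :: "'a \<Rightarrow> real" and p w r
  proof -
    note d = smooth_has_derivative[OF that, of "p + r *\<^sub>R w"]
    have "((\<lambda>r. p + r *\<^sub>R w) has_derivative (\<lambda>r. r *\<^sub>R w)) (at r)"
      by (auto intro!: derivative_eq_intros)
    from has_derivative_compose[OF this d]
    show ?thesis
      unfolding has_field_derivative_def
      by (rule has_derivative_eq_rhs)
        (simp add: linear_cmul[OF has_derivative_linear[OF d]] mult.commute fun_eq_iff)
  qed
  let ?P = "\<lambda>y. frechet_derivative f (at y) u"
  have "\<exists>s. 0 < s \<and> s < h \<and>
      (f (x + h *\<^sub>R v + h *\<^sub>R u) - f (x + h *\<^sub>R u)) - (f (x + h *\<^sub>R v + 0 *\<^sub>R u) - f (x + 0 *\<^sub>R u))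
      = (h - 0) * (?P (x + h *\<^sub>R v + s *\<^sub>R u) - ?P (x + s *\<^sub>R u))"
    by (rule MVT2[OF h]) (intro derivative_intros line[OF f])
  then obtain s where s: "0 < s" "s < h" and
    "(f (x + h *\<^sub>R v + h *\<^sub>R u) - f (x + h *\<^sub>R u)) - (f (x + h *\<^sub>R v + 0 *\<^sub>R u) - f (x + 0 *\<^sub>R u))
      = (h - 0) * (?P (x + h *\<^sub>R v + s *\<^sub>R u) - ?P (x + s *\<^sub>R u))"
    by blast
  moreover have "\<exists>t. 0 < t \<and> t < h \<and> ?P (x + s *\<^sub>R u + h *\<^sub>R v) - ?P (x + s *\<^sub>R u + 0 *\<^sub>R v)
      = (h - 0) * frechet_derivative ?P (at (x + s *\<^sub>R u + t *\<^sub>R v)) v"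
    by (rule MVT2[OF h]) (rule line[OF smooth_frechet_derivative[OF f]])
  then obtain t where t: "0 < t" "t < h" and
    "?P (x + s *\<^sub>R u + h *\<^sub>R v) - ?P (x + s *\<^sub>R u + 0 *\<^sub>R v)
      = (h - 0) * frechet_derivative ?P (at (x + s *\<^sub>R u + t *\<^sub>R v)) v"
    by blast
  ultimately show ?thesis
    using s t by (intro exI[of _ s] exI[of _ t]) (auto simp: algebra_simps)
qed

text \<open>By the mean value formula the two mixed derivatives agree at points of an arbitrarily small
  parallelogram at \<open>x\<close>, though not at the same point; continuity carries this over to \<open>x\<close>.\<close>

lemma second_derivative_symmetric_real:
  fixes f :: "'a::real_normed_vector \<Rightarrow> real"
  assumes f: "smooth f"
  shows "frechet_derivative (\<lambda>y. frechet_derivative f (at y) u) (at x) v =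
    frechet_derivative (\<lambda>y. frechet_derivative f (at y) v) (at x) u"
proof (rule ccontr)
  define Q where "Q u v y = frechet_derivative (\<lambda>y. frechet_derivative f (at y) u) (at y) v" for u v y
  assume "\<not> ?thesis"
  then have e: "0 < \<bar>Q u v x - Q v u x\<bar> / 2" by (simp add: Q_def)
  have cont: "continuous_on UNIV (Q a b)" for a b
    unfolding Q_def by (intro smooth_imp_continuous smooth_frechet_derivative f)
  obtain d1 where d1: "0 < d1" "\<And>y. dist y x < d1 \<Longrightarrow> dist (Q u v y) (Q u v x) < \<bar>Q u v x - Q v u x\<bar> / 2"
    using cont[of u v] e unfolding continuous_on_iff by blast
  obtain d2 where d2: "0 < d2" "\<And>y. dist y x < d2 \<Longrightarrow> dist (Q v u y) (Q v u x) < \<bar>Q u v x - Q v u x\<bar> / 2"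
    using cont[of v u] e unfolding continuous_on_iff by blast
  \<comment> \<open>The parallelogram of size \<open>h\<close> lies within both radii; the summand 1 covers \<open>u = v = 0\<close>.\<close>
  define h where "h = min d1 d2 / (norm u + norm v + 1)"
  have pos: "0 < norm u + norm v + 1"
    by (simp add: add_nonneg_pos)
  then have h: "0 < h" using d1 d2 by (simp add: h_def)
  have near: "dist (x + s *\<^sub>R u + t *\<^sub>R v) x < min d1 d2" if "0 < s" "s < h" "0 < t" "t < h" for s t
  proof -
    have "dist (x + s *\<^sub>R u + t *\<^sub>R v) x \<le> norm (s *\<^sub>R u) + norm (t *\<^sub>R v)"
      using norm_triangle_ineq[of "s *\<^sub>R u" "t *\<^sub>R v"] by (simp add: dist_norm algebra_simps)
    also have "\<dots> \<le> h * norm u + h * norm v"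
      using that by (intro add_mono) (auto intro: mult_right_mono)
    also have "\<dots> < h * (norm u + norm v + 1)"
      using h by (simp add: algebra_simps)
    also have "\<dots> = min d1 d2"
      using pos by (simp add: h_def)
    finally show ?thesis .
  qed
  obtain s t where st: "0 < s" "s < h" "0 < t" "t < h"
    "f (x + h *\<^sub>R u + h *\<^sub>R v) - f (x + h *\<^sub>R u) - f (x + h *\<^sub>R v) + f x =
      h * h * Q u v (x + s *\<^sub>R u + t *\<^sub>R v)"
    using second_difference_mean_value[OF f h, of x u v] unfolding Q_def by blast
  obtain t' s' where st': "0 < s'" "s' < h" "0 < t'" "t' < h"
    "f (x + h *\<^sub>R v + h *\<^sub>R u) - f (x + h *\<^sub>R v) - f (x + h *\<^sub>R u) + f x =
      h * h * Q v u (x + t' *\<^sub>R v + s' *\<^sub>R u)"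
    using second_difference_mean_value[OF f h, of x v u] unfolding Q_def by blast
  have swap: "x + h *\<^sub>R v + h *\<^sub>R u = x + h *\<^sub>R u + h *\<^sub>R v"
    "x + t' *\<^sub>R v + s' *\<^sub>R u = x + s' *\<^sub>R u + t' *\<^sub>R v"
    by (simp_all add: algebra_simps)
  have "h * h * Q u v (x + s *\<^sub>R u + t *\<^sub>R v) = h * h * Q v u (x + s' *\<^sub>R u + t' *\<^sub>R v)"
    using st(5) st'(5) unfolding swap by linarith
  then have "Q u v (x + s *\<^sub>R u + t *\<^sub>R v) = Q v u (x + s' *\<^sub>R u + t' *\<^sub>R v)"
    using h by simp
  moreover have "dist (Q u v (x + s *\<^sub>R u + t *\<^sub>R v)) (Q u v x) < \<bar>Q u v x - Q v u x\<bar> / 2"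
    using near[OF st(1-4)] d1(2) by simp
  moreover have "dist (Q v u (x + s' *\<^sub>R u + t' *\<^sub>R v)) (Q v u x) < \<bar>Q u v x - Q v u x\<bar> / 2"
    using near[OF st'(1-4)] d2(2) by simp
  ultimately show False by (simp add: dist_real_def) (auto simp: abs_if split: if_splits)
qed

lemma second_derivative_symmetric:
  fixes f :: "'a::real_normed_vector \<Rightarrow> 'b::euclidean_space"
  assumes f: "smooth f"
  shows "frechet_derivative (\<lambda>y. frechet_derivative f (at y) u) (at x) v =
    frechet_derivative (\<lambda>y. frechet_derivative f (at y) v) (at x) u"
proof (rule euclidean_eqI)
  fix b :: 'b
  note L = bounded_linear_inner_left[of b]
  have D: "frechet_derivative (\<lambda>y. F y \<bullet> b) (at x) w = frechet_derivative F (at x) w \<bullet> b"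
    if "smooth F" for F :: "'a \<Rightarrow> 'b" and x w
    using frechet_derivative_at[OF bounded_linear.has_derivative[OF L smooth_has_derivative[OF that]]]
    by metis
  show "frechet_derivative (\<lambda>y. frechet_derivative f (at y) u) (at x) v \<bullet> b =
    frechet_derivative (\<lambda>y. frechet_derivative f (at y) v) (at x) u \<bullet> b"
    using second_derivative_symmetric_real[OF smooth_linear[OF L f], of u x v]
    by (simp add: D f smooth_frechet_derivative)
qed

section \<open>Constant metrics are flat\<close>

lemma dir_deriv_has_derivative:
  "(f has_derivative f') (at x) \<Longrightarrow> dir_deriv X f x = f' (X x)"
  unfolding dir_deriv_def using frechet_derivative_at by metis

lemma linear_expand_Basis:
  fixes f :: "'a::euclidean_space \<Rightarrow> 'b::real_vector"
  assumes "linear f"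
  shows "f x = (\<Sum>b\<in>Basis. (x \<bullet> b) *\<^sub>R f b)"
  using linear_sum[OF assms, of "\<lambda>b. (x \<bullet> b) *\<^sub>R b" Basis]
  by (simp add: euclidean_representation linear_cmul[OF assms])

lemma dir_deriv_basis:
  fixes X :: "'a::euclidean_space \<Rightarrow> 'a"
  assumes "smooth f"
  shows "dir_deriv X f x = (\<Sum>b\<in>Basis. (X x \<bullet> b) *\<^sub>R frechet_derivative f (at x) b)"
  unfolding dir_deriv_def
  by (rule linear_expand_Basis
        [OF has_derivative_linear[OF smooth_has_derivative[OF assms]]])

text \<open>\<open>smooth\<close> speaks of derivatives in fixed directions, while \<open>X\<close> varies with the point; the
  expansion in the standard basis leads back to fixed directions.\<close>

lemma smooth_dir_deriv:
  assumes "smooth X" "smooth f"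
  shows "smooth (dir_deriv X f)"
proof -
  have "dir_deriv X f = (\<lambda>x. \<Sum>b\<in>Basis. (X x \<bullet> b) *\<^sub>R frechet_derivative f (at x) b)"
    by (intro ext dir_deriv_basis assms)
  then show ?thesis
    using assms by (auto intro!: smooth_sum smooth_scaleR smooth_frechet_derivative
        smooth_linear[OF bounded_linear_inner_left])
qed

text \<open>The second derivative in two varying directions splits into the Hessian of \<open>f\<close>, with \<open>Y\<close>
  frozen at \<open>x\<close>, and a term from the variation of \<open>Y\<close>. In a commutator the latter terms add up to
  the derivative along the Lie bracket.\<close>

lemma dir_deriv_dir_deriv:
  fixes X Y :: "'a::euclidean_space \<Rightarrow> 'a" and f :: "'a \<Rightarrow> 'b::real_normed_vector"
  assumes Y: "smooth Y" and f: "smooth f"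
  shows "dir_deriv X (dir_deriv Y f) x =
    frechet_derivative (\<lambda>y. frechet_derivative f (at y) (Y x)) (at x) (X x) +
    frechet_derivative f (at x) (dir_deriv X Y x)"
proof -
  let ?P = "\<lambda>b y. frechet_derivative f (at y) b"
  let ?D = "\<lambda>b. frechet_derivative (?P b) (at x) (X x)"
  note lin = linear_expand_Basis
        [OF has_derivative_linear[OF smooth_has_derivative[OF f]]]
  have P: "(?P b has_derivative frechet_derivative (?P b) (at x)) (at x)" for b
    by (rule smooth_has_derivative[OF smooth_frechet_derivative[OF f]])
  note [derivative_intros] = P
    bounded_linear.has_derivative[OF bounded_linear_inner_left smooth_has_derivative[OF Y]]
  have "dir_deriv Y f = (\<lambda>y. \<Sum>b\<in>Basis. (Y y \<bullet> b) *\<^sub>R ?P b y)"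
    by (intro ext dir_deriv_basis f)
  moreover have "((\<lambda>y. \<Sum>b\<in>Basis. (Y y \<bullet> b) *\<^sub>R ?P b y) has_derivative
      (\<lambda>v. \<Sum>b\<in>Basis. (Y x \<bullet> b) *\<^sub>R frechet_derivative (?P b) (at x) v
        + (frechet_derivative Y (at x) v \<bullet> b) *\<^sub>R ?P b x)) (at x)"
    by (intro derivative_intros)
  ultimately have 1: "dir_deriv X (dir_deriv Y f) x =
      (\<Sum>b\<in>Basis. (Y x \<bullet> b) *\<^sub>R ?D b + (dir_deriv X Y x \<bullet> b) *\<^sub>R ?P b x)"
    by (simp only: dir_deriv_has_derivative dir_deriv_def[of X Y])
  have "?P (Y x) = (\<lambda>y. \<Sum>b\<in>Basis. (Y x \<bullet> b) *\<^sub>R ?P b y)"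
    by (intro ext lin)
  moreover have "((\<lambda>y. \<Sum>b\<in>Basis. (Y x \<bullet> b) *\<^sub>R ?P b y) has_derivative
      (\<lambda>v. \<Sum>b\<in>Basis. (Y x \<bullet> b) *\<^sub>R frechet_derivative (?P b) (at x) v)) (at x)"
    by (intro derivative_intros)
  ultimately have 2: "?D (Y x) = (\<Sum>b\<in>Basis. (Y x \<bullet> b) *\<^sub>R ?D b)"
    by (simp only: frechet_derivative_at[symmetric])
  show ?thesis
    unfolding 1 2 sum.distrib using lin[of x "dir_deriv X Y x"] by simp
qed

text \<open>Componentwise differentiation is torsion-free by the very definition of the Lie bracket,
  and compatibility with the metric is the product rule for a constant bilinear map.\<close>

lemma levi_civita_constant_metric:
  fixes B :: "'a::euclidean_space \<Rightarrow> 'a \<Rightarrow> real"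
  assumes "bilinear B"
  shows "levi_civita_connection (\<lambda>_. B) dir_deriv"
proof -
  have lin: "frechet_derivative Y (at x) (c *\<^sub>R u + w) =
      c *\<^sub>R frechet_derivative Y (at x) u + frechet_derivative Y (at x) w"
    if "smooth Y" for Y :: "'a \<Rightarrow> 'a" and x u w c
    using has_derivative_linear[OF smooth_has_derivative[OF that, of x]]
    by (simp add: linear_add linear_cmul)
  have add1: "dir_deriv (\<lambda>y. X y + X' y) Y x = dir_deriv X Y x + dir_deriv X' Y x"
    if "smooth Y" for X X' Y :: "'a \<Rightarrow> 'a" and x
    using lin[OF that, of x 1] by (simp add: dir_deriv_def)
  have scale1: "dir_deriv (\<lambda>y. f y *\<^sub>R X y) Y x = f x *\<^sub>R dir_deriv X Y x"
    if "smooth Y" for X Y :: "'a \<Rightarrow> 'a" and f x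
    unfolding dir_deriv_def
    by (rule linear_cmul[OF has_derivative_linear[OF smooth_has_derivative[OF that]]])
  have add2: "dir_deriv X (\<lambda>y. Y y + Y' y) x = dir_deriv X Y x + dir_deriv X Y' x"
    if "smooth Y" "smooth Y'" for X Y Y' :: "'a \<Rightarrow> 'a" and x
    using dir_deriv_has_derivative[OF has_derivative_add[OF that[THEN smooth_has_derivative]]]
    by (simp add: dir_deriv_def)
  have scale2: "dir_deriv X (\<lambda>y. f y *\<^sub>R Y y) x = dir_deriv X f x *\<^sub>R Y x + f x *\<^sub>R dir_deriv X Y x"
    if "smooth f" "smooth Y" for X Y :: "'a \<Rightarrow> 'a" and f x
    using dir_deriv_has_derivative[OF has_derivative_scaleR[OF that[THEN smooth_has_derivative]]]
    by (simp add: dir_deriv_def add.commute)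
  have metric: "dir_deriv X (\<lambda>y. B (Y y) (Z y)) x = B (dir_deriv X Y x) (Z x) + B (Y x) (dir_deriv X Z x)"
    if "smooth Y" "smooth Z" for X Y Z :: "'a \<Rightarrow> 'a" and x
    using dir_deriv_has_derivative[OF bounded_bilinear.FDERIV
        [OF assms[unfolded bilinear_conv_bounded_bilinear] that[THEN smooth_has_derivative]]]
    by (simp add: dir_deriv_def add.commute)
  show ?thesis
    unfolding levi_civita_connection_def affine_connection_def vector_field_def
    by (simp add: smooth_dir_deriv add1 scale1 add2 scale2 metric lie_bracket_def)
qed

lemma flat_constant_metric:
  fixes B :: "'a::euclidean_space \<Rightarrow> 'a \<Rightarrow> real"
  assumes "bilinear B"
  shows "flat_metric (\<lambda>_. B)"
  unfolding flat_metric_def vector_field_def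
proof (intro exI[of _ dir_deriv] conjI allI impI)
  show "levi_civita_connection (\<lambda>_. B) dir_deriv"
    by (rule levi_civita_constant_metric[OF assms])
next
  fix X Y Z :: "'a \<Rightarrow> 'a" and x
  assume X: "smooth X" and Y: "smooth Y" and Z: "smooth Z"
  have "dir_deriv (lie_bracket X Y) Z x =
      frechet_derivative Z (at x) (dir_deriv X Y x) - frechet_derivative Z (at x) (dir_deriv Y X x)"
    unfolding dir_deriv_def[of "lie_bracket X Y"] lie_bracket_def
    by (rule linear_diff[OF has_derivative_linear[OF smooth_has_derivative[OF Z]]])
  then show "curvature dir_deriv X Y Z x = 0"
    unfolding curvature_def dir_deriv_dir_deriv[OF Y Z] dir_deriv_dir_deriv[OF X Z]
    using second_derivative_symmetric[OF Z, of "X x" x "Y x"] by simp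
qed

section \<open>The flat paracontact metric structure\<close>

theorem mainTheorem2:
  fixes \<eta> :: "real ^ 3 \<Rightarrow> real ^ 3 \<Rightarrow> real"
    and \<xi> :: "real ^ 3 \<Rightarrow> real ^ 3"
    and g :: "real ^ 3 \<Rightarrow> real ^ 3 \<Rightarrow> real ^ 3 \<Rightarrow> real"
  assumes "\<eta> = (\<lambda>x v. 1/2 * (cosh (x $ 3) * v $ 1 + sinh (x $ 3) * v $ 2))"
    and "\<xi> = (\<lambda>x. 2 *\<^sub>R (cosh (x $ 3) *\<^sub>R axis 1 1 - sinh (x $ 3) *\<^sub>R axis 2 1))"
    and "g = (\<lambda>x u v. 1/4 * (u $ 1 * v $ 1 - u $ 2 * v $ 2 + u $ 3 * v $ 3))"
  shows "(\<exists>\<phi>. paracontact_metric_structure \<phi> \<xi> \<eta> g) \<and> flat_metric g \<and>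
    (\<exists>\<phi>' \<xi>' \<eta>' (g' :: real ^ 3 \<Rightarrow> real ^ 3 \<Rightarrow> real ^ 3 \<Rightarrow> real).
       paracontact_metric_structure \<phi>' \<xi>' \<eta>' g' \<and> flat_metric g')"
proof -
  define E :: "real ^ 3 \<Rightarrow> real ^ 3"
    where "E x = cosh (x $ 3) *\<^sub>R axis 2 1 - sinh (x $ 3) *\<^sub>R axis 1 1" for x
  define \<phi> :: "real ^ 3 \<Rightarrow> real ^ 3 \<Rightarrow> real ^ 3"
    where "\<phi> x v = v $ 3 *\<^sub>R E x + (sinh (x $ 3) * v $ 1 + cosh (x $ 3) * v $ 2) *\<^sub>R axis 3 1" for x v
  note smooth_hyp = smooth_cosh_sinh_linear[OF bounded_linear_vec_nth]
  note smooths = smooth_add smooth_diff smooth_scaleR smooth_mult smooth_const smooth_hyp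
  have E_nth: "E x $ 1 = - sinh (x $ 3)" "E x $ 2 = cosh (x $ 3)" "E x $ 3 = 0" for x
    by (simp_all add: E_def axis_def)
  have \<phi>_nth: "\<phi> x v $ 1 = - sinh (x $ 3) * v $ 3" "\<phi> x v $ 2 = cosh (x $ 3) * v $ 3"
    "\<phi> x v $ 3 = sinh (x $ 3) * v $ 1 + cosh (x $ 3) * v $ 2" for x v
    by (simp_all add: \<phi>_def E_nth axis_def)
  have \<xi>_nth: "\<xi> x $ 1 = 2 * cosh (x $ 3)" "\<xi> x $ 2 = - 2 * sinh (x $ 3)" "\<xi> x $ 3 = 0" for x
    by (simp_all add: assms(2) axis_def)
  have hyp: "cosh z * cosh z = 1 + sinh z * sinh z" for z :: real
    using cosh_square_eq[of z] by (simp add: power2_eq_square)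
  have hyp': "cosh z * (cosh z * a) = a + sinh z * (sinh z * a)" for z a :: real
    using hyp[of z] by (metis distrib_right mult.assoc mult_1)
  note eq3 = vec_eq_iff forall_3 \<phi>_nth \<xi>_nth E_nth

  have tensor: "tensor_field_1_1 \<phi>"
    unfolding tensor_field_1_1_def
  proof (intro conjI allI)
    show "linear (\<phi> x)" for x
      by (rule linearI) (simp_all add: eq3 algebra_simps)
    show "smooth (\<lambda>x. \<phi> x v)" for v
      unfolding \<phi>_def E_def by (intro smooths)
  qed
  have form: "one_form \<eta>"
    unfolding one_form_def
  proof (intro conjI allI)
    show "linear (\<eta> x)" for x
      by (rule linearI) (simp_all add: assms(1) algebra_simps add_divide_distrib)
    show "smooth (\<lambda>x. \<eta> x v)" for v
      unfolding assms(1) by (intro smooths)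
  qed
  have field: "vector_field \<xi>"
    unfolding vector_field_def assms(2) by (intro smooths)
  have \<phi>\<xi>: "\<phi> x (\<xi> x) = 0" and \<eta>\<phi>: "\<eta> x (\<phi> x v) = 0" and \<eta>\<xi>: "\<eta> x (\<xi> x) = 1"
    and \<phi>\<phi>: "\<phi> x (\<phi> x v) = v - \<eta> x v *\<^sub>R \<xi> x" for x v
    by (simp_all add: eq3 assms(1) algebra_simps hyp hyp')
  \<comment> \<open>The two eigenvalues are treated at once: \<open>\<phi>\<close> interchanges \<open>E\<close> and \<open>\<partial>\<^sub>3\<close>, so for \<open>e = \<plusminus>1\<close>
    the vector \<open>e E + \<partial>\<^sub>3\<close> has eigenvalue \<open>e\<close>.\<close>
  have eigen: "dim {v. \<eta> x v = 0 \<and> \<phi> x v = e *\<^sub>R v} = 1" if "e * e = 1" for x e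
  proof -
    let ?w = "e *\<^sub>R E x + axis 3 1"
    have "{v. \<eta> x v = 0 \<and> \<phi> x v = e *\<^sub>R v} = span {?w}"
    proof (intro equalityI subsetI)
      fix v assume "v \<in> {v. \<eta> x v = 0 \<and> \<phi> x v = e *\<^sub>R v}"
      then have v: "\<phi> x v = e *\<^sub>R v" by simp
      have "e *\<^sub>R \<phi> x v = (e * e) *\<^sub>R v" using v by simp
      then have "v = e *\<^sub>R \<phi> x v" using that by simp
      then have "v $ 1 = e * (- sinh (x $ 3) * v $ 3)" "v $ 2 = e * (cosh (x $ 3) * v $ 3)"
        using \<phi>_nth by (metis vector_scaleR_component real_scaleR_def)+
      then have "v = v $ 3 *\<^sub>R ?w"
        by (simp add: eq3 axis_def)
      then show "v \<in> span {?w}"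
        by (metis span_base span_mul singletonI)
    next
      fix v assume "v \<in> span {?w}"
      then obtain c where "v = c *\<^sub>R ?w" by (auto simp: span_singleton)
      then show "v \<in> {v. \<eta> x v = 0 \<and> \<phi> x v = e *\<^sub>R v}"
        using that by (auto simp: eq3 assms(1) axis_def algebra_simps hyp hyp')
    qed
    moreover have "?w $ 3 = 1" by (simp add: E_nth axis_def)
    then have "?w \<noteq> 0" by (metis zero_index zero_neq_one)
    ultimately show ?thesis by (simp add: dim_insert)
  qed
  have almost: "almost_paracontact_structure \<phi> \<xi> \<eta>"
    unfolding almost_paracontact_structure_def
  proof (intro conjI allI exI[of _ 1] tensor form field \<phi>\<xi> \<eta>\<phi> \<eta>\<xi> \<phi>\<phi> impI)
    show "DIM(real ^ 3) = 2 * 1 + 1" by simp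
    show "\<phi> x (\<phi> x v) = v" if "\<eta> x v = 0" for x v
      using that by (simp add: \<phi>\<phi>)
    show "dim {v. \<eta> x v = 0 \<and> \<phi> x v = v} = 1" for x
      using eigen[of 1 x] by simp
    show "dim {v. \<eta> x v = 0 \<and> \<phi> x v = - v} = 1" for x
      using eigen[of "- 1" x] by simp
  qed

  have bil: "bilinear (g x)" for x
    unfolding bilinear_def assms(3) by (auto intro!: linearI simp: algebra_simps add_divide_distrib diff_divide_distrib)
  have metric: "pseudo_riemannian_metric g"
    unfolding pseudo_riemannian_metric_def
  proof (intro conjI allI impI bil)
    show "smooth (\<lambda>x. g x u v)" for u v
      unfolding assms(3) by (rule smooth_const)
    show "g x u v = g x v u" for x u v
      by (simp add: assms(3) algebra_simps)
    show "u = 0" if "\<forall>v. g x u v = 0" for x u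
      using that[rule_format, of "axis 1 1"] that[rule_format, of "axis 2 1"]
        that[rule_format, of "axis 3 1"]
      by (simp add: assms(3) axis_def vec_eq_iff forall_3)
  qed
  have compatible: "g x (\<phi> x u) (\<phi> x v) = - g x u v + \<eta> x u * \<eta> x v" for x u v
    by (simp add: assms(1,3) \<phi>_nth field_simps hyp hyp')

  have d\<eta>: "g x (X x) (\<phi> x (Y x)) = ext_deriv \<eta> X Y x"
    if X: "smooth X" and Y: "smooth Y" for X Y x
  proof -
    \<comment> \<open>The derivative of \<open>\<eta>(Z)\<close> splits into \<open>\<eta>\<close> of the derivative of \<open>Z\<close>, which the bracket cancels
      in \<open>d\<eta>\<close>, and the derivative of the coefficients of \<open>\<eta>\<close>.\<close>
    have D: "dir_deriv W (\<lambda>y. \<eta> y (Z y)) x =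
        \<eta> x (dir_deriv W Z x) + 1/2 * (W x $ 3 * (sinh (x $ 3) * Z x $ 1 + cosh (x $ 3) * Z x $ 2))"
      if "smooth Z" for W Z
    proof -
      note hyp_deriv = has_derivative_cosh_sinh_linear[OF bounded_linear_vec_nth]
      note nth_deriv = bounded_linear.has_derivative[OF bounded_linear_vec_nth smooth_has_derivative[OF that]]
      have "((\<lambda>y. \<eta> y (Z y)) has_derivative (\<lambda>v. \<eta> x (frechet_derivative Z (at x) v) +
          1/2 * (v $ 3 * (sinh (x $ 3) * Z x $ 1 + cosh (x $ 3) * Z x $ 2)))) (at x)"
        unfolding assms(1)
        by (rule has_derivative_eq_rhs, (rule has_derivative_mult_right has_derivative_add
            has_derivative_mult hyp_deriv nth_deriv)+) (simp add: fun_eq_iff algebra_simps)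
      from dir_deriv_has_derivative[OF this, of W] show ?thesis
        by (simp add: dir_deriv_def)
    qed
    have "\<eta> x (lie_bracket X Y x) = \<eta> x (dir_deriv X Y x) - \<eta> x (dir_deriv Y X x)"
      unfolding lie_bracket_def by (simp add: assms(1) field_simps)
    then show ?thesis
      unfolding ext_deriv_def D[OF X] D[OF Y] by (simp add: assms(3) \<phi>_nth field_simps)
  qed

  have paracontact: "paracontact_metric_structure \<phi> \<xi> \<eta> g"
    unfolding paracontact_metric_structure_def almost_paracontact_metric_structure_def vector_field_def
    using almost metric compatible d\<eta> by blast
  have flat: "flat_metric g"
    using flat_constant_metric[OF bil] unfolding assms(3) .
  from paracontact flat show ?thesis by blast
qed

end
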